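(* Let $f:\mathbb{R}\to\mathbb{C}$ be a function that is differentiable on $\mathbb{R}$, integrable on every bounded interval, and satisfies $f(x)=0$ for all $x\le 0$. Let $s\in\mathbb{C}$ with $\operatorname{Re}(s)>0$. Then for every $x> 0$ the integral $$J^s(f)(x)=\frac{1}{\Gamma(s)}\int_0^x (x-y)^{s-1}f(y)\,dy$$ is absolutely convergent.
   Context: $\Gamma$ is the Euler gamma function. For $t>0$ and $s\in\mathbb{C}$, $t^{s-1}=e^{(s-1)\ln t}$. *)

theory Defs
  imports "HOL-Analysis.Analysis"
begin

(* For y < x the base x - y is a positive real, so powr is exp ((s - 1) * ln (x - y)). *)
definition RL_integrand :: "complex \<Rightarrow> (real \<Rightarrow> complex) \<Rightarrow> real \<Rightarrow> real \<Rightarrow> complex" where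
  "RL_integrand s f x y = complex_of_real (x - y) powr (s - 1) * f y"

(* The operator J^s. The interval integral LBINT y=0..x is the Lebesgue integral over the
   open interval (0, x) when 0 < x; it is absolutely convergent iff
   interval_lebesgue_integrable holds of its integrand. The factor 1 / Gamma s does not
   depend on y. *)
definition RL_integral :: "complex \<Rightarrow> (real \<Rightarrow> complex) \<Rightarrow> real \<Rightarrow> complex" where
  "RL_integral s f x = 1 / Gamma s * (LBINT y=0..x. RL_integrand s f x y)"

end

theory Submission
  imports Defs
begin

text \<open>
  On \<open>(0, x)\<close> the kernel \<open>(x - y) powr (s - 1)\<close> has modulus \<open>(x - y) powr (Re s - 1)\<close>, whose only
  singularity, at \<open>y = x\<close>, is integrable because the exponent exceeds \<open>-1\<close>. A differentiable
  function is continuous, hence bounded on the compact interval \<open>[0, x]\<close>, so the integrand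
  is dominated by a constant multiple of this integrable function.
\<close>

lemma set_integrable_powr_at_0:
  fixes a x :: real
  assumes "a > -1" and "x \<ge> 0"
  shows "set_integrable lborel {0..x} (\<lambda>t. t powr a)"
proof -
  have "(\<lambda>t. t powr a) absolutely_integrable_on {0..x}"
    using has_integral_powr_from_0[OF assms]
    by (intro nonnegative_absolutely_integrable_1) (auto simp: integrable_on_def)
  then show ?thesis
    by (simp add: set_integrable_def integrable_completion)
qed

text \<open>The reflection \<open>y \<mapsto> x - y\<close> preserves Lebesgue measure and moves the singularity from the
  left end of the interval to the right end.\<close>
lemma set_integrable_powr_diff:
  fixes a x :: real
  assumes "a > -1" and "x \<ge> 0"
  shows "set_integrable lborel {0..x} (\<lambda>y. (x - y) powr a)"
proof -
  have "integrable lborel (\<lambda>y. indicator {0..x} (x + (-1) * y) *\<^sub>R (x + (-1) * y) powr a)"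
    using set_integrable_powr_at_0[OF assms] unfolding set_integrable_def
    by (intro lborel_integrable_real_affine) auto
  moreover have "indicator {0..x} (x + (-1) * y) = (indicator {0..x} y :: real)" for y
    by (auto simp: indicator_def)
  ultimately show ?thesis
    by (simp add: set_integrable_def)
qed

lemma set_integrable_RL_integrand:
  fixes f :: "real \<Rightarrow> complex" and s :: complex
  assumes cont: "continuous_on {0..x} f" and s: "Re s > 0" and x: "x > 0"
  shows "set_integrable lborel {0<..<x} (RL_integrand s f x)"
proof -
  have "bounded (f ` {0..x})"
    using cont by (intro compact_imp_bounded compact_continuous_image) auto
  then obtain B where B: "\<And>y. y \<in> {0..x} \<Longrightarrow> norm (f y) \<le> B"
    unfolding bounded_iff by blast
  have kernel: "set_integrable lborel {0<..<x} (\<lambda>y. B * (x - y) powr (Re s - 1))"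
    by (intro set_integrable_mult_right set_integrable_subset[OF set_integrable_powr_diff])
       (use s x in auto)
  have cont_integrand: "continuous_on {0<..<x} (RL_integrand s f x)"
    unfolding RL_integrand_def
    by (intro continuous_intros continuous_on_subset[OF cont])
       (auto simp: complex_nonpos_Reals_iff)
  have norm_le: "norm (RL_integrand s f x y) \<le> B * (x - y) powr (Re s - 1)" if "y \<in> {0<..<x}" for y
  proof -
    have "norm (complex_of_real (x - y) powr (s - 1)) = (x - y) powr (Re s - 1)"
      using that by (subst norm_powr_real_powr) auto
    then show ?thesis
      using that B[of y]
      by (auto simp: RL_integrand_def norm_mult mult.commute intro!: mult_right_mono)
  qed
  show ?thesis
  proof (rule set_integrable_bound[OF kernel])
    show "set_borel_measurable lborel {0<..<x} (RL_integrand s f x)"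
      using borel_measurable_continuous_on_indicator[OF _ cont_integrand]
      by (simp add: set_borel_measurable_def)
    show "AE y in lborel. y \<in> {0<..<x} \<longrightarrow>
        norm (RL_integrand s f x y) \<le> norm (B * (x - y) powr (Re s - 1))"
      using norm_le by (intro AE_I2) (force intro: order_trans[OF _ abs_ge_self])
  qed
qed

theorem theorem1:
  fixes f :: "real \<Rightarrow> complex" and s :: complex
  assumes "f differentiable_on UNIV"
    and "\<And>a b. set_integrable lborel {a..b} f"
    and "\<And>x. x \<le> 0 \<Longrightarrow> f x = 0"
    and "Re s > 0"
  shows "\<forall>x::real. x > 0 \<longrightarrow> interval_lebesgue_integrable lborel 0 x (RL_integrand s f x)"
proof (intro allI impI)
  fix x :: real
  assume x: "x > 0"
  have "continuous_on {0..x} f"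
    using differentiable_imp_continuous_on[OF assms(1)] continuous_on_subset by blast
  then have "set_integrable lborel {0<..<x} (RL_integrand s f x)"
    using assms(4) x by (rule set_integrable_RL_integrand)
  then show "interval_lebesgue_integrable lborel 0 x (RL_integrand s f x)"
    using x by (simp add: interval_lebesgue_integrable_def zero_ereal_def)
qed

end
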